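(* Let $R=\bigoplus_{d\ge 0}R_d$ be a positively graded commutative Noetherian ring which is standard, i.e. $R=R_0[R_1]$, with $R_0$ a local ring. Let $I,J$ be ideals of $R$ and let $M$ be an $(I,J)$-torsion $R$-module for which $(JM:_{M}I)$ is an Artinian module. Then $M$ is an Artinian module.
   Context: For ideals $I,J$ of $R$ and an $R$-module $M$, $\Gamma_{I,J}(M)=\{x\in M : I^{n}x\subseteq Jx \text{ for some integer } n\ge 1\}$; $M$ is called $(I,J)$-torsion if $\Gamma_{I,J}(M)=M$. $(JM:_M I)=\{x\in M: Ix\subseteq JM\}$. *)

theory Defs
  imports "HOL-Algebra.Algebra"
begin

text \<open>
  A grading by the natural numbers, given by its family of homogeneous components.
  The internal direct sum is expressed by existence and uniqueness of the
  decomposition into finitely many nonzero homogeneous parts.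
\<close>

locale nat_graded_cring = cring R for R (structure) +
  fixes G :: "nat \<Rightarrow> 'a set"
  assumes component_subgroup: "additive_subgroup (G d) R"
    and component_mult: "\<lbrakk>a \<in> G d; b \<in> G e\<rbrakk> \<Longrightarrow> a \<otimes> b \<in> G (d + e)"
    and decomposition: "x \<in> carrier R \<Longrightarrow>
      \<exists>!f. (\<forall>d. f d \<in> G d) \<and> finite {d. f d \<noteq> \<zero>} \<and> x = (\<Oplus>d\<in>{d. f d \<noteq> \<zero>}. f d)"

locale standard_graded_cring = nat_graded_cring +
  assumes generated_in_degree_one: "generate_ring R (G 0 \<union> G 1) = carrier R"

definition local_ring :: "('a, 'b) ring_scheme \<Rightarrow> bool"
  where "local_ring A \<longleftrightarrow> cring A \<and> (\<exists>!\<mm>. maximalideal \<mm> A)"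

definition artinian_module :: "('a, 'b) ring_scheme \<Rightarrow> ('a, 'c, 'd) module_scheme \<Rightarrow> bool"
  where "artinian_module R M \<longleftrightarrow> module R M \<and>
    (\<forall>N :: nat \<Rightarrow> 'c set. (\<forall>k. submodule (N k) R M) \<longrightarrow> (\<forall>k. N (Suc k) \<subseteq> N k) \<longrightarrow>
      (\<exists>m. \<forall>k\<ge>m. N k = N m))"

text \<open>The submodule \<open>JM\<close>, built like \<^const>\<open>ideal_prod\<close>; it contains zero as soon as \<open>J\<close> does.\<close>

inductive_set ideal_smult ::
    "('a, 'b) ring_scheme \<Rightarrow> ('a, 'c, 'd) module_scheme \<Rightarrow> 'a set \<Rightarrow> 'c set"
  for R and M and J where
    smult: "\<lbrakk>a \<in> J; x \<in> carrier M\<rbrakk> \<Longrightarrow> a \<odot>\<^bsub>M\<^esub> x \<in> ideal_smult R M J"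
  | add: "\<lbrakk>x \<in> ideal_smult R M J; y \<in> ideal_smult R M J\<rbrakk> \<Longrightarrow> x \<oplus>\<^bsub>M\<^esub> y \<in> ideal_smult R M J"

definition module_colon :: "('a, 'c, 'd) module_scheme \<Rightarrow> 'c set \<Rightarrow> 'a set \<Rightarrow> 'c set"
  where "module_colon M N I = {x \<in> carrier M. \<forall>a\<in>I. a \<odot>\<^bsub>M\<^esub> x \<in> N}"

text \<open>Powers of ideals are taken in the monoid \<^term>\<open>ideals_set R\<close>.\<close>

definition pair_torsion ::
    "('a, 'b) ring_scheme \<Rightarrow> 'a set \<Rightarrow> 'a set \<Rightarrow> ('a, 'c, 'd) module_scheme \<Rightarrow> 'c set"
  where "pair_torsion R I J M =
    {x \<in> carrier M. \<exists>n::nat. n \<ge> 1 \<and>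
      (\<lambda>a. a \<odot>\<^bsub>M\<^esub> x) ` (I [^]\<^bsub>ideals_set R\<^esub> n) \<subseteq> (\<lambda>a. a \<odot>\<^bsub>M\<^esub> x) ` J}"

definition is_pair_torsion ::
    "('a, 'b) ring_scheme \<Rightarrow> 'a set \<Rightarrow> 'a set \<Rightarrow> ('a, 'c, 'd) module_scheme \<Rightarrow> bool"
  where "is_pair_torsion R I J M \<longleftrightarrow> pair_torsion R I J M = carrier M"

lemma (in module) submodule_ideal_smult:
  assumes "ideal J R"
  shows "submodule (ideal_smult R M J) R M"
proof -
  interpret J: ideal J R by fact
  have carr: "x \<in> carrier M" if "x \<in> ideal_smult R M J" for x
    using that by induction auto
  have smult: "b \<odot>\<^bsub>M\<^esub> x \<in> ideal_smult R M J"
    if "x \<in> ideal_smult R M J" "b \<in> carrier R" for b x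
    using that
  proof induction
    case (smult a x)
    then have "b \<odot>\<^bsub>M\<^esub> (a \<odot>\<^bsub>M\<^esub> x) = (b \<otimes> a) \<odot>\<^bsub>M\<^esub> x"
      by (simp add: smult_assoc1)
    then show ?case
      using smult by (metis J.I_l_closed ideal_smult.smult)
  next
    case (add x y)
    then show ?case
      by (simp add: carr smult_r_distr ideal_smult.add)
  qed
  have zero: "\<zero>\<^bsub>M\<^esub> \<in> ideal_smult R M J"
    using ideal_smult.smult[of \<zero> J "\<zero>\<^bsub>M\<^esub>" M R] by simp
  have neg: "\<ominus>\<^bsub>M\<^esub> x \<in> ideal_smult R M J" if "x \<in> ideal_smult R M J" for x
    using smult[OF that, of "\<ominus> \<one>"] carr[OF that] by (simp add: smult_l_minus)
  show ?thesis
    by (rule submoduleI) (auto simp: carr zero neg smult intro: ideal_smult.add)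
qed

lemma (in module) submodule_module_colon:
  assumes "submodule N R M" "ideal I R"
  shows "submodule (module_colon M N I) R M"
proof -
  interpret N: submodule N R M by fact
  interpret I: ideal I R by fact
  have N0: "\<zero>\<^bsub>M\<^esub> \<in> N"
    using N.one_closed by simp
  note E = submoduleE[OF assms(1)]
  show ?thesis
  proof (rule submoduleI)
    fix a x assume a: "a \<in> carrier R" and x: "x \<in> module_colon M N I"
    have "b \<odot>\<^bsub>M\<^esub> (a \<odot>\<^bsub>M\<^esub> x) \<in> N" if "b \<in> I" for b
    proof -
      have "b \<odot>\<^bsub>M\<^esub> (a \<odot>\<^bsub>M\<^esub> x) = (b \<otimes> a) \<odot>\<^bsub>M\<^esub> x"
        using a x that by (simp add: module_colon_def smult_assoc1)
      then show ?thesis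
        using a x that I.I_r_closed by (simp add: module_colon_def)
    qed
    then show "a \<odot>\<^bsub>M\<^esub> x \<in> module_colon M N I"
      using a x by (simp add: module_colon_def)
  qed (auto simp: module_colon_def N0 E smult_r_distr smult_r_minus)
qed

end

theory Submission
  imports Defs
begin

text \<open>
  As \<open>I\<close> is finitely generated and every \<open>x\<close> in \<open>M\<close> satisfies \<open>I\<^sup>n x \<subseteq> JM\<close> for some \<open>n\<close>, an
  induction on the generators reduces the theorem to a principal ideal \<open>(a)\<close>. For a descending
  chain \<open>N\<^sub>i\<close> of submodules, the submodules \<open>a\<^sup>k N\<^sub>i \<inter> (JM : a)\<close> descend in \<open>i\<close> and in \<open>k\<close>,
  hence they are stationary in \<open>i\<close> uniformly in \<open>k\<close>. If \<open>x \<in> N\<^sub>i\<close> and \<open>a\<^sup>k\<^sup>+\<^sup>1 x \<in> JM\<close>, then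
  \<open>a\<^sup>k x = a\<^sup>k y\<close> for some \<open>y\<close> in a later member of the chain, and \<open>x - y\<close> is killed by \<open>a\<^sup>k\<close>, so
  induction on \<open>k\<close> puts \<open>x\<close> in the later member as well.
\<close>

section \<open>Doubly indexed descending chains\<close>

text \<open>Once the diagonal is constant from \<open>m\<close> on, every \<open>L j k\<close> with
  \<open>j\<close>, \<open>k\<close> at least \<open>m\<close> is squeezed between
  \<open>L m m\<close> and a later diagonal member. Only the finitely many rows \<open>k < m\<close>
  remain, and each has its own bound.\<close>

lemma double_chain_stabilizes:
  fixes L :: "nat \<Rightarrow> nat \<Rightarrow> 'c set"
  assumes mono: "\<And>i i' k k'. i \<le> i' \<Longrightarrow> k \<le> k' \<Longrightarrow> L i' k' \<subseteq> L i k"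
    and rows: "\<And>k. \<exists>m. \<forall>i\<ge>m. L i k = L m k"
    and diagonal: "\<exists>m. \<forall>i\<ge>m. L i i = L m m"
  shows "\<exists>m. \<forall>i\<ge>m. \<forall>k. L i k = L m k"
proof -
  obtain c where c: "\<And>i k. i \<ge> c k \<Longrightarrow> L i k = L (c k) k"
    using rows by metis
  obtain m where m: "\<And>i. i \<ge> m \<Longrightarrow> L i i = L m m"
    using diagonal by blast
  \<comment> \<open>The sum serves as a common upper bound of the \<open>c k\<close> with
    \<open>k < m\<close>.\<close>
  define n where "n = m + (\<Sum>k<m. c k)"
  have "L i k = L n k" if "i \<ge> n" for i k
  proof (cases "k < m")
    case True
    then have "c k \<le> n"
      using member_le_sum[of k "{..<m}" c] by (simp add: n_def)
    then show ?thesis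
      using c that by (metis order_trans)
  next
    case False
    have "L j k = L m m" if "j \<ge> m" for j
    proof
      show "L j k \<subseteq> L m m"
        using mono[of m j m k] False that by simp
      have "L (max j k) (max j k) \<subseteq> L j k"
        by (rule mono) auto
      then show "L m m \<subseteq> L j k"
        using m[of "max j k"] that by (simp add: le_max_iff_disj)
    qed
    moreover have "m \<le> n" by (simp add: n_def)
    ultimately show ?thesis
      using that by simp
  qed
  then show ?thesis by blast
qed

section \<open>Restricted modules and colon submodules\<close>

context module
begin

text \<open>Restricting the carrier changes neither addition nor scalar action. Chains inside
  \<open>Q\<close> can thus be treated as chains of submodules of the fixed module
  \<open>M\<close>.\<close>

lemma submodule_restrict_iff:
  assumes "submodule Q R M"
  shows "submodule N R (M\<lparr>carrier := Q\<rparr>) \<longleftrightarrow> submodule N R M \<and> N \<subseteq> Q"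
proof -
  have Q: "subgroup Q (add_monoid M)"
    using assms by (rule submodule.axioms)
  have eq: "add_monoid (M\<lparr>carrier := Q\<rparr>) = (add_monoid M)\<lparr>carrier := Q\<rparr>"
    by simp
  have "subgroup N (add_monoid (M\<lparr>carrier := Q\<rparr>)) \<longleftrightarrow> subgroup N (add_monoid M) \<and> N \<subseteq> Q"
    unfolding eq
    using add.incl_subgroup[OF Q] add.subgroup_incl[OF _ Q] subgroup.subset by fastforce
  then show ?thesis
    by (auto simp: submodule_def submodule_axioms_def)
qed

lemma artinian_restrict_iff:
  assumes "submodule Q R M"
  shows "artinian_module R (M\<lparr>carrier := Q\<rparr>) \<longleftrightarrow>
    (\<forall>N :: nat \<Rightarrow> _. (\<forall>k. submodule (N k) R M \<and> N k \<subseteq> Q) \<longrightarrow> (\<forall>k. N (Suc k) \<subseteq> N k) \<longrightarrow>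
      (\<exists>m. \<forall>k\<ge>m. N k = N m))"
  using submodule.submodule_is_module[OF assms module_axioms]
  by (simp add: artinian_module_def submodule_restrict_iff[OF assms])

lemma submodule_Int:
  assumes "submodule A R M" "submodule B R M"
  shows "submodule (A \<inter> B) R M"
proof (rule submoduleI)
  show "\<zero>\<^bsub>M\<^esub> \<in> A \<inter> B"
    using assms[THEN submodule.axioms(1), THEN subgroup.one_closed] by simp
qed (use submoduleE[OF assms(1)] submoduleE[OF assms(2)] in auto)

lemma submodule_smult_image:
  assumes "submodule N R M" "a \<in> carrier R"
  shows "submodule ((\<lambda>x. a \<odot>\<^bsub>M\<^esub> x) ` N) R M"
proof (rule submoduleI)
  note E = submoduleE[OF assms(1)]
  note [simp] = subsetD[OF E(1)]
  show "(\<lambda>x. a \<odot>\<^bsub>M\<^esub> x) ` N \<subseteq> carrier M"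
    using assms(2) by auto
  have "\<zero>\<^bsub>M\<^esub> \<in> N"
    using submodule.axioms(1)[OF assms(1), THEN subgroup.one_closed] by simp
  then show "\<zero>\<^bsub>M\<^esub> \<in> (\<lambda>x. a \<odot>\<^bsub>M\<^esub> x) ` N"
    using smult_r_null[OF assms(2)] by (metis imageI)
  show "\<ominus>\<^bsub>M\<^esub> y \<in> (\<lambda>x. a \<odot>\<^bsub>M\<^esub> x) ` N" if "y \<in> (\<lambda>x. a \<odot>\<^bsub>M\<^esub> x) ` N" for y
    using that assms(2) E(3) by (auto simp flip: smult_r_minus)
  show "y \<oplus>\<^bsub>M\<^esub> z \<in> (\<lambda>x. a \<odot>\<^bsub>M\<^esub> x) ` N"
    if "y \<in> (\<lambda>x. a \<odot>\<^bsub>M\<^esub> x) ` N" "z \<in> (\<lambda>x. a \<odot>\<^bsub>M\<^esub> x) ` N" for y z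
    using that assms(2) E(5) by (auto simp flip: smult_r_distr)
  show "b \<odot>\<^bsub>M\<^esub> y \<in> (\<lambda>x. a \<odot>\<^bsub>M\<^esub> x) ` N"
    if b: "b \<in> carrier R" and y: "y \<in> (\<lambda>x. a \<odot>\<^bsub>M\<^esub> x) ` N" for b y
  proof -
    obtain x where x: "x \<in> N" "y = a \<odot>\<^bsub>M\<^esub> x"
      using y by blast
    then have "b \<odot>\<^bsub>M\<^esub> y = a \<odot>\<^bsub>M\<^esub> (b \<odot>\<^bsub>M\<^esub> x)"
      using assms(2) b by (metis E(1) m_comm smult_assoc1 subsetD)
    then show ?thesis
      using x b E(4) by auto
  qed
qed

text \<open>For fixed \<open>x\<close>, the scalars that carry \<open>x\<close> into
  \<open>N\<close> form an ideal, which contains \<open>Idl S\<close> as soon as it contains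
  \<open>S\<close>.\<close>

lemma module_colon_genideal:
  assumes N: "submodule N R M" and S: "S \<subseteq> carrier R"
  shows "module_colon M N (Idl S) = module_colon M N S"
proof
  show "module_colon M N (Idl S) \<subseteq> module_colon M N S"
    using genideal_self[OF S] by (auto simp: module_colon_def)
  note E = submoduleE[OF N]
  show "module_colon M N S \<subseteq> module_colon M N (Idl S)"
  proof
    fix x assume x: "x \<in> module_colon M N S"
    then have xM: "x \<in> carrier M"
      by (simp add: module_colon_def)
    have "\<zero>\<^bsub>M\<^esub> \<in> N"
      using submodule.axioms(1)[OF N, THEN subgroup.one_closed] by simp
    then have "subgroup {r \<in> carrier R. r \<odot>\<^bsub>M\<^esub> x \<in> N} (add_monoid R)"
      using xM E(3,5)
      by (intro subgroup.intro) (auto simp: smult_l_distr smult_l_minus simp flip: a_inv_def)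
    moreover have "s \<otimes> r \<odot>\<^bsub>M\<^esub> x \<in> N" if "r \<in> carrier R" "r \<odot>\<^bsub>M\<^esub> x \<in> N" "s \<in> carrier R" for r s
      using that xM E(4) by (simp add: smult_assoc1)
    ultimately have "ideal {r \<in> carrier R. r \<odot>\<^bsub>M\<^esub> x \<in> N} R"
      by (intro idealI R.ring_axioms) (auto simp: m_comm)
    moreover have "S \<subseteq> {r \<in> carrier R. r \<odot>\<^bsub>M\<^esub> x \<in> N}"
      using x S by (auto simp: module_colon_def)
    ultimately have "Idl S \<subseteq> {r \<in> carrier R. r \<odot>\<^bsub>M\<^esub> x \<in> N}"
      by (rule genideal_minimal)
    then show "x \<in> module_colon M N (Idl S)"
      using xM by (auto simp: module_colon_def)
  qed
qed

lemma submodule_module_colon_set: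
  assumes "submodule N R M" "S \<subseteq> carrier R"
  shows "submodule (module_colon M N S) R M"
  using submodule_module_colon[OF assms(1) genideal_ideal[OF assms(2)]]
  by (simp add: module_colon_genideal[OF assms])

section \<open>Lifting the Artinian property from a colon submodule\<close>

text \<open>A general \<open>Q\<close> is allowed in place of \<open>carrier M\<close> because the
  induction on generators applies this to intermediate colon submodules, while \<open>P\<close>
  stays fixed.\<close>

lemma artinian_if_artinian_colon_principal:
  assumes P: "submodule P R M" and Q: "submodule Q R M" and a: "a \<in> carrier R"
    and torsion: "\<And>x. x \<in> Q \<Longrightarrow> \<exists>n::nat. (a [^] n) \<odot>\<^bsub>M\<^esub> x \<in> P"
    and artinian: "artinian_module R (M\<lparr>carrier := Q \<inter> module_colon M P {a}\<rparr>)"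
  shows "artinian_module R (M\<lparr>carrier := Q\<rparr>)"
  unfolding artinian_restrict_iff[OF Q]
proof (intro allI impI)
  fix N :: "nat \<Rightarrow> _"
  assume N: "\<forall>k. submodule (N k) R M \<and> N k \<subseteq> Q" and dec: "\<forall>k. N (Suc k) \<subseteq> N k"
  define K where "K = Q \<inter> module_colon M P {a}"
  have K: "submodule K R M"
    unfolding K_def using P Q a by (simp add: submodule_Int submodule_module_colon_set)
  have Nsub: "submodule (N i) R M" and NQ: "N i \<subseteq> Q" for i
    using N by auto
  note QM = submoduleE(1)[OF Q]
  have Nanti: "N i' \<subseteq> N i" if "i \<le> i'" for i i'
    using lift_Suc_antimono_le[of N, OF _ that] dec by blast
  define L where "L i k = (\<lambda>x. (a [^] k) \<odot>\<^bsub>M\<^esub> x) ` N i \<inter> K" for i k :: nat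
  have Lsub: "submodule (L i k) R M \<and> L i k \<subseteq> K" for i k
    unfolding L_def using K Nsub a by (simp add: submodule_Int submodule_smult_image)
  have Lanti: "L i' k' \<subseteq> L i k" if "i \<le> i'" "k \<le> k'" for i i' k k'
  proof -
    have "(a [^] k') \<odot>\<^bsub>M\<^esub> x \<in> (\<lambda>x. (a [^] k) \<odot>\<^bsub>M\<^esub> x) ` N i" if x: "x \<in> N i'" for x
    proof -
      have "a [^] k' = a [^] k \<otimes> a [^] (k' - k)"
        using a \<open>k \<le> k'\<close> by (simp add: nat_pow_mult)
      moreover have "x \<in> carrier M"
        using x NQ QM by blast
      ultimately have "(a [^] k') \<odot>\<^bsub>M\<^esub> x = (a [^] k) \<odot>\<^bsub>M\<^esub> ((a [^] (k' - k)) \<odot>\<^bsub>M\<^esub> x)"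
        using a by (simp add: smult_assoc1)
      moreover have "(a [^] (k' - k)) \<odot>\<^bsub>M\<^esub> x \<in> N i"
        using x a Nanti[OF \<open>i \<le> i'\<close>] submoduleE(4)[OF Nsub] by blast
      ultimately show ?thesis
        by blast
    qed
    then show ?thesis
      by (auto simp: L_def)
  qed
  have stab: "\<exists>m. \<forall>k\<ge>m. F k = F m"
    if "\<And>k. submodule (F k) R M \<and> F k \<subseteq> K" "\<And>k. F (Suc k) \<subseteq> F k" for F :: "nat \<Rightarrow> _"
    using artinian that unfolding K_def[symmetric] artinian_restrict_iff[OF K] by blast
  \<comment> \<open>Each row and the diagonal are descending chains of submodules of the Artinian
    module \<open>K\<close>.\<close>
  have "\<exists>m. \<forall>i\<ge>m. \<forall>k. L i k = L m k"
    by (rule double_chain_stabilizes) (auto intro!: Lanti stab Lsub del: subsetI)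
  then obtain m where m: "\<And>i k. i \<ge> m \<Longrightarrow> L i k = L m k"
    by blast
  \<comment> \<open>The index \<open>m\<close> is the same for all \<open>k\<close>, although the
    exponent that moves \<open>x\<close> into \<open>P\<close> varies with \<open>x\<close>. The
    element stays arbitrary because the induction hypothesis is applied to a difference
    \<open>x - y\<close>.\<close>
  have "x \<in> N i" if i: "i \<ge> m" and x: "x \<in> N m" "(a [^] k) \<odot>\<^bsub>M\<^esub> x \<in> P" for i x and k :: nat
    using x
  proof (induction k arbitrary: x)
    case 0
    have xM: "x \<in> carrier M"
      using 0 NQ QM by blast
    then have "x \<in> P"
      using 0 by simp
    \<comment> \<open>From \<open>x\<close> in \<open>P\<close> follows \<open>a x\<close> in
      \<open>P\<close>, so \<open>x\<close> lies in \<open>K\<close>; and \<open>L m 0\<close> is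
      \<open>N m\<close> cut down to \<open>K\<close>.\<close>
    then have "x \<in> L m 0"
      using 0 xM NQ a submoduleE(4)[OF P] by (force simp: L_def K_def module_colon_def)
    then have "x \<in> L i 0"
      using m[OF i] by simp
    then show ?case
      using NQ QM by (auto simp: L_def subset_iff)
  next
    case (Suc k)
    have xM: "x \<in> carrier M"
      using Suc NQ QM by blast
    have "a \<odot>\<^bsub>M\<^esub> ((a [^] k) \<odot>\<^bsub>M\<^esub> x) \<in> P"
      using Suc.prems(2) a xM by (simp add: m_comm flip: smult_assoc1)
    moreover have "(a [^] k) \<odot>\<^bsub>M\<^esub> x \<in> Q"
      using Suc.prems(1) NQ a submoduleE(4)[OF Q] by blast
    ultimately have "(a [^] k) \<odot>\<^bsub>M\<^esub> x \<in> L m k"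
      using Suc.prems(1) a xM by (simp add: L_def K_def module_colon_def)
    then have "(a [^] k) \<odot>\<^bsub>M\<^esub> x \<in> L i k"
      using m[OF i] by simp
    then obtain y where y: "y \<in> N i" "(a [^] k) \<odot>\<^bsub>M\<^esub> x = (a [^] k) \<odot>\<^bsub>M\<^esub> y"
      by (auto simp: L_def)
    have yM: "y \<in> carrier M"
      using y NQ QM by blast
    have "(a [^] k) \<odot>\<^bsub>M\<^esub> (x \<oplus>\<^bsub>M\<^esub> \<ominus>\<^bsub>M\<^esub> y) = \<zero>\<^bsub>M\<^esub>"
      using a xM yM y(2) by (simp add: smult_r_distr smult_r_minus M.r_neg)
    moreover have "\<zero>\<^bsub>M\<^esub> \<in> P"
      using submodule.axioms(1)[OF P, THEN subgroup.one_closed] by simp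
    moreover have "x \<oplus>\<^bsub>M\<^esub> \<ominus>\<^bsub>M\<^esub> y \<in> N m"
      using Suc.prems(1) y(1) Nanti[OF i] submoduleE(3,5)[OF Nsub] by blast
    ultimately have "x \<oplus>\<^bsub>M\<^esub> \<ominus>\<^bsub>M\<^esub> y \<in> N i"
      using Suc.IH by simp
    then have "(x \<oplus>\<^bsub>M\<^esub> \<ominus>\<^bsub>M\<^esub> y) \<oplus>\<^bsub>M\<^esub> y \<in> N i"
      using y(1) submoduleE(5)[OF Nsub] by blast
    then show ?case
      using xM yM by (simp add: M.a_assoc M.l_neg)
  qed
  then have "N i = N m" if "i \<ge> m" for i
    using that Nanti torsion NQ by blast
  then show "\<exists>m. \<forall>k\<ge>m. N k = N m"
    by blast
qed

lemma artinian_if_artinian_colon_finite: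
  assumes "finite S" and P: "submodule P R M" and "S \<subseteq> carrier R" and "submodule Q R M"
    and "\<And>x a. x \<in> Q \<Longrightarrow> a \<in> S \<Longrightarrow> \<exists>n::nat. (a [^] n) \<odot>\<^bsub>M\<^esub> x \<in> P"
    and "artinian_module R (M\<lparr>carrier := Q \<inter> module_colon M P S\<rparr>)"
  shows "artinian_module R (M\<lparr>carrier := Q\<rparr>)"
  using assms(1,3-)
proof (induction S)
  case empty
  have "Q \<inter> module_colon M P {} = Q"
    using submoduleE(1)[OF empty.prems(2)] by (auto simp: module_colon_def)
  then show ?case
    using empty.prems by simp
next
  case (insert a S)
  \<comment> \<open>Cutting \<open>Q'\<close> further by the colon of \<open>a\<close> gives the
    submodule assumed Artinian, so the principal case makes \<open>Q'\<close> Artinian. The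
    induction hypothesis for \<open>S\<close> then passes from \<open>Q'\<close> to
    \<open>Q\<close>.\<close>
  define Q' where "Q' = Q \<inter> module_colon M P S"
  have Q': "submodule Q' R M"
    unfolding Q'_def using insert.prems P by (simp add: submodule_Int submodule_module_colon_set)
  have "Q' \<inter> module_colon M P {a} = Q \<inter> module_colon M P (insert a S)"
    by (auto simp: Q'_def module_colon_def)
  then have "artinian_module R (M\<lparr>carrier := Q'\<rparr>)"
    using insert.prems Q'
    by (intro artinian_if_artinian_colon_principal[OF P, of Q' a]) (auto simp: Q'_def)
  then show ?case
    using insert by (simp add: Q'_def)
qed

end

section \<open>From the ideal to its generators\<close>

lemma (in cring) nat_pow_in_ideals_set_pow:
  assumes "ideal I R" "a \<in> I"
  shows "a [^] (n::nat) \<in> I [^]\<^bsub>ideals_set R\<^esub> n"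
proof (induction n)
  case 0
  then show ?case
    by (simp add: ideals_set_def)
next
  case (Suc n)
  then show ?case
    using assms(2) ideal_prod.prod by (fastforce simp: ideals_set_def)
qed

theorem proposition3p2:
  fixes R :: "('a, 'b) ring_scheme" (structure)
    and G :: "nat \<Rightarrow> 'a set"
    and M :: "('a, 'c, 'd) module_scheme"
    and I J :: "'a set"
  assumes "standard_graded_cring R G"
    and "noetherian_ring R"
    and "local_ring (R\<lparr>carrier := G 0\<rparr>)"
    and "ideal I R" and "ideal J R"
    and "module R M"
    and "is_pair_torsion R I J M"
    and "artinian_module R (M\<lparr>carrier := module_colon M (ideal_smult R M J) I\<rparr>)"
  shows "artinian_module R M"
proof -
  interpret module R M by fact
  interpret noetherian_ring R by fact
  have P: "submodule (ideal_smult R M J) R M"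
    using assms(5) by (rule submodule_ideal_smult)
  \<comment> \<open>The Noetherian hypothesis supplies the finite set of generators for the
    induction.\<close>
  obtain S where S: "S \<subseteq> carrier R" "finite S" "I = Idl S"
    using finetely_gen[OF assms(4)] by blast
  have torsion: "\<exists>n::nat. (a [^] n) \<odot>\<^bsub>M\<^esub> x \<in> ideal_smult R M J"
    if x: "x \<in> carrier M" and a: "a \<in> S" for x a
  proof -
    have "x \<in> pair_torsion R I J M"
      using assms(7) x by (simp add: is_pair_torsion_def)
    then obtain n :: nat where
      n: "(\<lambda>a. a \<odot>\<^bsub>M\<^esub> x) ` (I [^]\<^bsub>ideals_set R\<^esub> n) \<subseteq> (\<lambda>a. a \<odot>\<^bsub>M\<^esub> x) ` J"
      by (auto simp: pair_torsion_def)
    have "a \<in> I"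
      using a S genideal_self by blast
    then have "(a [^] n) \<odot>\<^bsub>M\<^esub> x \<in> (\<lambda>a. a \<odot>\<^bsub>M\<^esub> x) ` J"
      using n nat_pow_in_ideals_set_pow[OF assms(4)] by blast
    moreover have "(\<lambda>a. a \<odot>\<^bsub>M\<^esub> x) ` J \<subseteq> ideal_smult R M J"
      using x by (auto intro: ideal_smult.smult)
    ultimately show ?thesis
      by blast
  qed
  \<comment> \<open>This brings the hypothesis on the colon by \<open>I\<close> into the form needed
    for \<open>Q = carrier M\<close> and the generators \<open>S\<close>.\<close>
  have "carrier M \<inter> module_colon M (ideal_smult R M J) S = module_colon M (ideal_smult R M J) I"
    using module_colon_genideal[OF P S(1)] S(3) by (auto simp: module_colon_def)
  then have "artinian_module R (M\<lparr>carrier := carrier M\<rparr>)"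
    using artinian_if_artinian_colon_finite[OF S(2) P S(1) carrier_is_submodule torsion] assms(8)
    by simp
  then show ?thesis
    by simp
qed

end
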